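(* Suppose that $\mathcal{T}\subset \mathbf{F}\subset \mathbf{E}$ are quasi-normed linear spaces and that $\mathbf{E}$ and $\mathbf{F}$ are complete. (i) If there exist $C>0$ and $\beta>0$ such that the Jackson-type inequality $$t^{\beta}\,\mathcal{E}(f,t,\mathbf{E},\mathcal{T})\le C\|f\|_{\mathbf{F}}\qquad\text{for all } t>0 \text{ and all } f\in\mathbf{F}$$ is satisfied, then the embedding $$(\mathbf{E},\mathbf{F})^{K}_{\theta,q}\subset \mathcal{E}_{\theta\beta,q}(\mathbf{E},\mathcal{T}),\qquad 0<\theta<1,\ 0<q\le\infty,$$ holds true. (ii) If there exist $C>0$ and $\beta>0$ such that the Bernstein-type inequality $$\|f\|_{\mathbf{F}}\le C\|f\|_{\mathcal{T}}^{\beta}\,\|f\|_{\mathbf{E}}\qquad\text{for all } f\in\mathcal{T}$$ holds, then the embedding $$\mathcal{E}_{\theta\beta,q}(\mathbf{E},\mathcal{T})\subset(\mathbf{E},\mathbf{F})^{K}_{\theta,q},\qquad 0<\theta<1,\ 0<q\le\infty,$$ holds true.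
   Context: A quasi-norm $\|\cdot\|_{\mathbf{E}}$ on a linear space $\mathbf{E}$ is a real-valued function such that for all $f,f_1,f_2\in\mathbf{E}$: (1) $\|f\|_{\mathbf{E}}\ge 0$; (2) $\|f\|_{\mathbf{E}}=0$ iff $f=0$; (3) $\|-f\|_{\mathbf{E}}=\|f\|_{\mathbf{E}}$; (4) there is $C_{\mathbf{E}}\ge 1$ with $\|f_1+f_2\|_{\mathbf{E}}\le C_{\mathbf{E}}(\|f_1\|_{\mathbf{E}}+\|f_2\|_{\mathbf{E}})$. (No homogeneity is required.) Two quasi-normed linear spaces $\mathbf{E},\mathbf{F}$ form a pair if they are linear subspaces of a common linear space $\mathbf{A}$ and the conditions $\|f_k-g\|_{\mathbf{E}}\to0$ and $\|f_k-h\|_{\mathbf{F}}\to 0$ imply $g=h$. The constructions below are made for pairs. Peetre's $K$-functional: for $f\in\mathbf{E}+\mathbf{F}$ and $t>0$, $K(f,t)=K(f,t,\mathbf{E},\mathbf{F})=\inf\{\|f_0\|_{\mathbf{E}}+t\|f_1\|_{\mathbf{F}}: f=f_0+f_1,\ f_0\in\mathbf{E},\ f_1\in\mathbf{F}\}$. For $0<\theta<1$, $0<q\le\infty$, the space $(\mathbf{E},\mathbf{F})^{K}_{\theta,q}$ is the set of $f\in\mathbf{E}+\mathbf{F}$ with $\|f\|_{\theta,q}=\left(\int_0^\infty (t^{-\theta}K(f,t))^{q}\frac{dt}{t}\right)^{1/q}<\infty$ (supremum over $t>0$ of $t^{-\theta}K(f,t)$ if $q=\infty$). For $t>0$, $\mathcal{E}(f,t,\mathbf{E},\mathbf{F})=\inf\{\|f-g\|_{\mathbf{E}}: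 g\in\mathbf{F},\ \|g\|_{\mathbf{F}}\le t\}$. For $0<\alpha<\infty$, $0<q\le\infty$, the approximation space $\mathcal{E}_{\alpha,q}(\mathbf{E},\mathbf{F})$ is the quasi-normed linear space of all $f\in\mathbf{E}+\mathbf{F}$ for which $\|f\|_{\mathcal{E}_{\alpha,q}(\mathbf{E},\mathbf{F})}=\left(\int_0^\infty(t^{\alpha}\mathcal{E}(f,t,\mathbf{E},\mathbf{F}))^{q}\frac{dt}{t}\right)^{1/q}$ is finite (supremum if $q=\infty$). An embedding is a continuous inclusion, i.e. an inclusion with the corresponding estimate of quasi-norms up to a constant. *)

theory Defs
  imports "HOL-Analysis.Analysis"
begin

(* A function on a linear subspace of the ambient linear space 'a.
   The values of qnorm outside elems carry no meaning. *)
record 'a qspace =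
  elems :: "'a set"
  qnorm :: "'a \<Rightarrow> real"

(* No homogeneity is required of a quasi-norm. *)
definition quasi_normed :: "'a::real_vector qspace \<Rightarrow> bool" where
  "quasi_normed E \<longleftrightarrow>
     subspace (elems E) \<and>
     (\<forall>f\<in>elems E. 0 \<le> qnorm E f) \<and>
     (\<forall>f\<in>elems E. qnorm E f = 0 \<longleftrightarrow> f = 0) \<and>
     (\<forall>f\<in>elems E. qnorm E (- f) = qnorm E f) \<and>
     (\<exists>C\<ge>1. \<forall>f\<^sub>1\<in>elems E. \<forall>f\<^sub>2\<in>elems E. qnorm E (f\<^sub>1 + f\<^sub>2) \<le> C * (qnorm E f\<^sub>1 + qnorm E f\<^sub>2))"

definition complete_qspace :: "'a::real_vector qspace \<Rightarrow> bool" where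
  "complete_qspace E \<longleftrightarrow>
     (\<forall>s::nat \<Rightarrow> 'a. (\<forall>k. s k \<in> elems E) \<and>
          (\<forall>\<epsilon>>0. \<exists>N. \<forall>m\<ge>N. \<forall>n\<ge>N. qnorm E (s m - s n) < \<epsilon>) \<longrightarrow>
        (\<exists>l\<in>elems E. (\<lambda>k. qnorm E (s k - l)) \<longlonglongrightarrow> 0))"

definition qspace_pair :: "'a::real_vector qspace \<Rightarrow> 'a qspace \<Rightarrow> bool" where
  "qspace_pair E F \<longleftrightarrow>
     quasi_normed E \<and> quasi_normed F \<and>
     (\<forall>(s::nat \<Rightarrow> 'a) g h.
        (\<forall>k. s k \<in> elems E \<inter> elems F) \<and> g \<in> elems E \<and> h \<in> elems F \<and>
        (\<lambda>k. qnorm E (s k - g)) \<longlonglongrightarrow> 0 \<and> (\<lambda>k. qnorm F (s k - h)) \<longlonglongrightarrow> 0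
        \<longrightarrow> g = h)"

definition sum_elems :: "'a::real_vector qspace \<Rightarrow> 'a qspace \<Rightarrow> 'a set" where
  "sum_elems E F = {f\<^sub>0 + f\<^sub>1 | f\<^sub>0 f\<^sub>1. f\<^sub>0 \<in> elems E \<and> f\<^sub>1 \<in> elems F}"

(* Continuous inclusion: the estimate of quasi-norms holds up to a constant. *)
definition embedding :: "'a qspace \<Rightarrow> 'a qspace \<Rightarrow> bool" where
  "embedding X Y \<longleftrightarrow>
     elems X \<subseteq> elems Y \<and> (\<exists>C>0. \<forall>f\<in>elems X. qnorm Y f \<le> C * qnorm X f)"

(* Only used with r > 0. *)
definition ennpowr :: "ennreal \<Rightarrow> real \<Rightarrow> ennreal" where
  "ennpowr x r = (if x = \<infinity> then \<infinity> else ennreal (enn2real x powr r))"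

(* The integral of (t^a h(t))^q dt/t over (0,\<infinity>) to the power 1/q,
   and the supremum of t^a h(t) over t > 0 for q = \<infinity>. *)
definition weighted_norm :: "real \<Rightarrow> ennreal \<Rightarrow> (real \<Rightarrow> ennreal) \<Rightarrow> ennreal" where
  "weighted_norm a q h =
     (if q = \<infinity> then (SUP t\<in>{0<..}. ennreal (t powr a) * h t)
      else ennpowr
        (\<integral>\<^sup>+ t\<in>{0<..}. ennpowr (ennreal (t powr a) * h t) (enn2real q) * ennreal (1 / t) \<partial>lborel)
        (1 / enn2real q))"

definition K_functional :: "'a::real_vector qspace \<Rightarrow> 'a qspace \<Rightarrow> 'a \<Rightarrow> real \<Rightarrow> ennreal" where
  "K_functional E F f t =
     Inf {ennreal (qnorm E f\<^sub>0 + t * qnorm F f\<^sub>1) | f\<^sub>0 f\<^sub>1.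
            f\<^sub>0 \<in> elems E \<and> f\<^sub>1 \<in> elems F \<and> f = f\<^sub>0 + f\<^sub>1}"

definition K_space ::
  "'a::real_vector qspace \<Rightarrow> 'a qspace \<Rightarrow> real \<Rightarrow> ennreal \<Rightarrow> 'a qspace" where
  "K_space E F \<theta> q =
     \<lparr> elems = {f \<in> sum_elems E F. weighted_norm (- \<theta>) q (K_functional E F f) < \<infinity>},
       qnorm = (\<lambda>f. enn2real (weighted_norm (- \<theta>) q (K_functional E F f))) \<rparr>"

(* The E-quasi-norm of f - g counts as infinite when f - g is not in E. *)
definition approx_error :: "'a::real_vector qspace \<Rightarrow> 'a qspace \<Rightarrow> 'a \<Rightarrow> real \<Rightarrow> ennreal" where
  "approx_error E F f t =
     Inf {ennreal (qnorm E (f - g)) | g. g \<in> elems F \<and> f - g \<in> elems E \<and> qnorm F g \<le> t}"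

definition approx_space ::
  "'a::real_vector qspace \<Rightarrow> 'a qspace \<Rightarrow> real \<Rightarrow> ennreal \<Rightarrow> 'a qspace" where
  "approx_space E F \<alpha> q =
     \<lparr> elems = {f \<in> sum_elems E F. weighted_norm \<alpha> q (approx_error E F f) < \<infinity>},
       qnorm = (\<lambda>f. enn2real (weighted_norm \<alpha> q (approx_error E F f))) \<rparr>"

end

theory Submission
  imports Defs
begin

text \<open>
  Both embeddings come from pointwise comparisons of the two functionals under the substitution
  \<open>t = s powr - \<beta>\<close>, which carries the weight \<open>t powr - \<theta>\<close> to \<open>s powr (\<theta> * \<beta>)\<close> and the measure
  \<open>dt/t\<close> to a multiple of \<open>ds/s\<close>.

  Under the Jackson inequality, split \<open>f = f0 + f1\<close> and approximate only \<open>f1\<close> from \<open>T\<close>. The error is at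
  most a constant times \<open>qnorm E f0 + s powr - \<beta> * qnorm F f1\<close>, and the infimum over all splittings
  bounds \<open>approx_error E T f s\<close> by a multiple of \<open>K_functional E F f (s powr - \<beta>)\<close>
  (\<open>approx_error_le_K_functional\<close>).

  Under the Bernstein inequality, choose approximants \<open>g j\<close> of \<open>f\<close> with \<open>T\<close>-quasi-norm at most
  \<open>\<mu> ^ j * s\<close>, where \<open>0 < \<mu> < 1\<close> and the error may grow geometrically in \<open>j\<close>, and use the splitting \<open>f = (f - g 0) + g 0\<close>. The \<open>F\<close>-quasi-norm of \<open>g 0\<close> is
  estimated by telescoping down the levels: each difference \<open>g j - g (j + 1)\<close> lies in \<open>T\<close>, where the
  Bernstein inequality applies, and the far end \<open>g m\<close> of the chain, itself an element of \<open>T\<close>, is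
  controlled by the same inequality.

  The difficulty is that a quasi-norm constant \<open>cF\<close> makes the \<open>j\<close>-th term of a telescoping sum cost an
  extra factor \<open>cF ^ j\<close>. Usually one passes to an equivalent \<open>p\<close>-subadditive quasi-norm and then needs
  Hardy's inequality. Here the ratio \<open>\<mu>\<close> of consecutive levels is instead taken so small that
  \<open>\<mu> powr \<beta>\<close> beats \<open>cF\<close> with room to spare. What remains is a bound of the \<open>K\<close>-functional by
  a \<^emph>\<open>supremum\<close> of geometrically damped dilates of the approximation error
  (\<open>K_functional_le_SUP_approx_error\<close>). A supremum is at most the \<open>\<ell>\<^sup>q\<close>-sum for every \<open>q > 0\<close>, so
  dilation invariance of \<open>dt/t\<close> and a geometric series settle all exponents alike
  (\<open>weighted_norm_SUP_dilates\<close>).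
\<close>

section \<open>Powers of extended nonnegative reals\<close>

lemma ennpowr_ennreal: "0 \<le> x \<Longrightarrow> ennpowr (ennreal x) r = ennreal (x powr r)"
  by (simp add: ennpowr_def)

lemma ennpowr_top [simp]: "ennpowr top r = top"
  by (simp add: ennpowr_def)

lemma ennpowr_mono:
  assumes "x \<le> y" "0 \<le> r"
  shows "ennpowr x r \<le> ennpowr y r"
proof (cases "y = top")
  case False
  with assms have "x \<noteq> top" by (auto simp: top_unique)
  with False assms show ?thesis
    by (auto simp: ennpowr_def less_top intro!: ennreal_leI powr_mono2 enn2real_mono)
qed simp

lemma ennpowr_mult:
  assumes "0 < r"
  shows "ennpowr (x * y) r = ennpowr x r * ennpowr y r"
  using assms
  by (cases x; cases y)
     (auto simp: ennpowr_def ennreal_mult_eq_top_iff ennreal_mult_top ennreal_top_mult powr_mult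
        simp flip: ennreal_mult ennreal_mult_top)

lemma ennpowr_ennpowr: "ennpowr (ennpowr x r) s = ennpowr x (r * s)"
  by (cases x) (auto simp: ennpowr_def powr_powr)

lemma ennpowr_one [simp]: "ennpowr x 1 = x"
  by (cases x) (auto simp: ennpowr_def)

lemma measurable_ennpowr [measurable (raw)]:
  assumes [measurable]: "f \<in> borel_measurable M"
  shows "(\<lambda>x. ennpowr (f x) r) \<in> borel_measurable M"
  unfolding ennpowr_def by measurable

section \<open>The multiplicatively invariant integral on the positive half-line\<close>

text \<open>Both functionals are monotone in their real argument. Sublevel sets of a monotone function are
  intervals.\<close>

lemma borel_measurable_mono_ennreal:
  fixes h :: "real \<Rightarrow> ennreal"
  assumes "mono h \<or> antimono h"
  shows "h \<in> borel_measurable borel"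
proof (rule borel_measurableI_less)
  fix y
  have "is_interval {x. h x < y}"
    using assms unfolding is_interval_1 mono_def antimono_def
    by (auto; meson le_less_trans)
  then show "{x \<in> space borel. h x < y} \<in> sets borel"
    by (simp add: real_interval_borel_measurable)
qed

definition log_integral :: "(real \<Rightarrow> ennreal) \<Rightarrow> ennreal" where
  "log_integral h = (\<integral>\<^sup>+ t\<in>{0<..}. h t * ennreal (1 / t) \<partial>lborel)"

text \<open>The substitution \<open>t = exp u\<close> turns \<open>dt/t\<close> into Lebesgue measure on the whole line. It is available
  for compact intervals; exhausting the line by \<open>[- n - 1, n + 1]\<close> and using continuity from below of
  the two density measures gives the unbounded case.\<close>

lemma log_integral_exp:
  assumes [measurable]: "h \<in> borel_measurable borel"
  shows "log_integral h = (\<integral>\<^sup>+ u. h (exp u) \<partial>lborel)"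
proof -
  define P where "P = density lborel (\<lambda>t. h t * ennreal (1 / t))"
  define Q where "Q = density lborel (\<lambda>u. h (exp u))"
  define I where "I = (\<lambda>n::nat. {exp (- real (Suc n))..exp (real (Suc n))})"
  define J where "J = (\<lambda>n::nat. {- real (Suc n)..real (Suc n)})"
  have PQ: "emeasure P (I n) = emeasure Q (J n)" for n
  proof -
    have "emeasure P (I n) = (\<integral>\<^sup>+ t. (h t * ennreal (1 / t)) * indicator {exp (- real (Suc n))..exp (real (Suc n))} t \<partial>lborel)"
      unfolding P_def I_def by (subst emeasure_density) auto
    also have "\<dots> = (\<integral>\<^sup>+ u. (h (exp u) * ennreal (1 / exp u)) * ennreal (exp u) * indicator {- real (Suc n)..real (Suc n)} u \<partial>lborel)"
      by (rule nn_integral_substitution_aux) (auto intro!: derivative_eq_intros continuous_intros)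
    also have "\<dots> = (\<integral>\<^sup>+ u. h (exp u) * indicator {- real (Suc n)..real (Suc n)} u \<partial>lborel)"
      by (intro nn_integral_cong) (simp add: mult.assoc flip: ennreal_mult)
    also have "\<dots> = emeasure Q (J n)"
      unfolding Q_def J_def by (subst emeasure_density) auto
    finally show ?thesis .
  qed
  have "(\<Union>n. J n) = UNIV"
  proof (intro equalityI subsetI UNIV_I)
    fix x :: real
    obtain n where "\<bar>x\<bar> \<le> real n" using real_arch_simple by blast
    then have "x \<in> J n" by (auto simp: J_def)
    then show "x \<in> (\<Union>n. J n)" by blast
  qed
  moreover have "(\<Union>n. I n) = {0<..}"
  proof (intro equalityI subsetI)
    fix t :: real assume "t \<in> {0<..}"
    then have t: "exp (ln t) = t" by simp
    obtain n where "\<bar>ln t\<bar> \<le> real n" using real_arch_simple by blast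
    then have "exp (- real (Suc n)) \<le> exp (ln t)" "exp (ln t) \<le> exp (real (Suc n))" by auto
    then have "t \<in> I n" unfolding t by (simp add: I_def)
    then show "t \<in> (\<Union>n. I n)" by blast
  next
    fix t assume "t \<in> (\<Union>n. I n)"
    then obtain n where "exp (- real (Suc n)) \<le> t" by (auto simp: I_def)
    then show "t \<in> {0<..}" using exp_gt_zero[of "- real (Suc n)"] by (simp only: greaterThan_iff)
  qed
  moreover have "incseq I" "incseq J" by (auto simp: incseq_def I_def J_def intro: order_trans)
  moreover have meas: "range I \<subseteq> sets P" "range J \<subseteq> sets Q"
    by (auto simp: I_def J_def P_def Q_def)
  ultimately have "emeasure P {0<..} = emeasure Q UNIV"
    using SUP_emeasure_incseq[of I P, OF meas(1)] SUP_emeasure_incseq[of J Q, OF meas(2)] PQ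
    by simp
  then show ?thesis
    by (simp add: P_def Q_def log_integral_def emeasure_density)
qed

text \<open>In the logarithmic variable, \<open>t \<mapsto> c * t powr b\<close> is the affine map \<open>u \<mapsto> ln c + b * u\<close>.\<close>

lemma log_integral_powr:
  assumes [measurable]: "h \<in> borel_measurable borel" and "0 < c" "b \<noteq> 0"
  shows "log_integral h = ennreal \<bar>b\<bar> * log_integral (\<lambda>t. h (c * t powr b))"
proof -
  have "log_integral h = (\<integral>\<^sup>+ u. h (exp u) \<partial>lborel)"
    by (rule log_integral_exp) simp
  also have "\<dots> = ennreal \<bar>b\<bar> * (\<integral>\<^sup>+ u. h (exp (ln c + b * u)) \<partial>lborel)"
    by (rule nn_integral_real_affine) (use assms in auto)
  also have "(\<integral>\<^sup>+ u. h (exp (ln c + b * u)) \<partial>lborel) = (\<integral>\<^sup>+ u. h (c * exp u powr b) \<partial>lborel)"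
    using assms by (simp add: exp_add powr_def)
  also have "\<dots> = log_integral (\<lambda>t. h (c * t powr b))"
    by (rule log_integral_exp[symmetric]) measurable
  finally show ?thesis .
qed

lemma log_integral_dilate:
  assumes [measurable]: "h \<in> borel_measurable borel" and "0 < c"
  shows "log_integral (\<lambda>t. h (c * t)) = log_integral h"
proof -
  have "log_integral (\<lambda>t. h (c * t)) = log_integral (\<lambda>t. h (c * t powr 1))"
    unfolding log_integral_def by (intro nn_integral_cong) (auto simp: indicator_def)
  then show ?thesis using log_integral_powr[of h c 1] assms by simp
qed

lemma log_integral_mono:
  "(\<And>t. 0 < t \<Longrightarrow> h t \<le> k t) \<Longrightarrow> log_integral h \<le> log_integral k"
  unfolding log_integral_def
  by (intro nn_integral_mono) (auto simp: indicator_def intro!: mult_right_mono)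

lemma log_integral_cmult:
  "h \<in> borel_measurable borel \<Longrightarrow> log_integral (\<lambda>t. c * h t) = c * log_integral h"
  unfolding log_integral_def by (simp add: mult.assoc nn_integral_cmult)

lemma log_integral_suminf:
  fixes h :: "nat \<Rightarrow> real \<Rightarrow> ennreal"
  assumes [measurable]: "\<And>j. h j \<in> borel_measurable borel"
  shows "log_integral (\<lambda>t. \<Sum>j. h j t) = (\<Sum>j. log_integral (h j))"
  unfolding log_integral_def by (simp add: nn_integral_suminf flip: ennreal_suminf_multc)

section \<open>Weighted norms\<close>

lemma weighted_norm_finite_exponent:
  assumes "q \<noteq> \<infinity>"
  shows "weighted_norm a q h =
    ennpowr (log_integral (\<lambda>t. ennpowr (ennreal (t powr a) * h t) (enn2real q))) (1 / enn2real q)"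
  using assms by (simp add: weighted_norm_def log_integral_def)

text \<open>For \<open>q = \<infinity>\<close> the constant is meant to be 1, and it is: \<open>enn2real \<infinity> = 0\<close>, hence
  \<open>1 / enn2real q = 0\<close> and \<open>\<bar>b\<bar> powr 0 = 1\<close>.\<close>

lemma weighted_norm_powr:
  assumes [measurable]: "h \<in> borel_measurable borel" and "b \<noteq> 0" "0 < q"
  shows "weighted_norm a q h =
    ennreal (\<bar>b\<bar> powr (1 / enn2real q)) * weighted_norm (a * b) q (\<lambda>t. h (t powr b))"
proof (cases "q = \<infinity>")
  case True
  have img: "(\<lambda>t::real. t powr b) ` {0<..} = {0<..}"
  proof (intro equalityI subsetI)
    fix t :: real assume "t \<in> {0<..}"
    then have "t = (t powr (1 / b)) powr b" "t powr (1 / b) \<in> {0<..}"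
      using assms by (auto simp: powr_powr)
    then show "t \<in> (\<lambda>t. t powr b) ` {0<..}" by blast
  qed auto
  have "weighted_norm a q h = (SUP t\<in>(\<lambda>t. t powr b) ` {0<..}. ennreal (t powr a) * h t)"
    unfolding img by (simp add: True weighted_norm_def)
  also have "\<dots> = weighted_norm (a * b) q (\<lambda>t. h (t powr b))"
    by (simp add: True weighted_norm_def image_image powr_powr mult.commute)
  finally show ?thesis using assms by (simp add: True)
next
  case False
  define p where "p = enn2real q"
  have p: "0 < p" using False \<open>0 < q\<close> by (simp add: p_def enn2real_positive_iff less_top)
  have "log_integral (\<lambda>t. ennpowr (ennreal (t powr a) * h t) p)
      = ennreal \<bar>b\<bar> * log_integral (\<lambda>t. ennpowr (ennreal ((1 * t powr b) powr a) * h (1 * t powr b)) p)"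
    by (rule log_integral_powr) (use assms in auto)
  then show ?thesis
    using p by (simp add: weighted_norm_finite_exponent[OF False] p_def[symmetric] ennpowr_mult
      ennpowr_ennreal powr_powr mult.commute)
qed

lemma weighted_norm_mono:
  assumes "\<And>t. 0 < t \<Longrightarrow> h t \<le> k t" "0 < q"
  shows "weighted_norm a q h \<le> weighted_norm a q k"
proof (cases "q = \<infinity>")
  case True
  have "ennreal (t powr a) * h t \<le> (SUP t\<in>{0<..}. ennreal (t powr a) * k t)" if "0 < t" for t
    using that assms(1)[OF that] by (intro SUP_upper2[of t]) (auto intro: mult_left_mono)
  then show ?thesis
    unfolding weighted_norm_def by (auto simp: True intro!: SUP_least)
next
  case False
  then show ?thesis
    unfolding weighted_norm_finite_exponent[OF False]
    by (intro ennpowr_mono log_integral_mono mult_left_mono assms) auto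
qed

lemma weighted_norm_cmult:
  assumes [measurable]: "h \<in> borel_measurable borel" and "0 \<le> M" "0 < q"
  shows "weighted_norm a q (\<lambda>t. ennreal M * h t) = ennreal M * weighted_norm a q h"
proof (cases "q = \<infinity>")
  case True
  then show ?thesis
    by (simp add: weighted_norm_def SUP_mult_left_ennreal mult.left_commute)
next
  case False
  define p where "p = enn2real q"
  have p: "0 < p" using False \<open>0 < q\<close> by (simp add: p_def enn2real_positive_iff less_top)
  have "ennreal (t powr a) * (ennreal M * h t) = ennreal M * (ennreal (t powr a) * h t)" for t
    by (simp add: mult.left_commute)
  then show ?thesis
    using p assms unfolding weighted_norm_finite_exponent[OF False] p_def[symmetric]
    by (simp add: ennpowr_mult log_integral_cmult ennpowr_ennreal powr_powr ennpowr_ennpowr)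
qed

text \<open>The \<open>\<ell>\<^sup>\<infinity>\<close>-norm is at most the \<open>\<ell>\<^sup>r\<close>-norm for every \<open>r > 0\<close>, also below 1, because each
  term is at most the \<open>r\<close>-th root of the sum of the \<open>r\<close>-th powers.\<close>

lemma ennpowr_SUP_le_suminf:
  fixes u :: "nat \<Rightarrow> ennreal"
  assumes "0 < r"
  shows "ennpowr (SUP j. u j) r \<le> (\<Sum>j. ennpowr (u j) r)"
proof -
  let ?S = "\<Sum>j. ennpowr (u j) r"
  have "u j \<le> ennpowr ?S (1 / r)" for j
  proof -
    have "ennpowr (u j) r \<le> ?S"
      using sum_le_suminf[of "\<lambda>j. ennpowr (u j) r" "{j}"] by simp
    then have "ennpowr (ennpowr (u j) r) (1 / r) \<le> ennpowr ?S (1 / r)"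
      using assms by (intro ennpowr_mono) auto
    then show ?thesis using assms by (simp add: ennpowr_ennpowr)
  qed
  then have "(SUP j. u j) \<le> ennpowr ?S (1 / r)" by (rule SUP_least)
  then have "ennpowr (SUP j. u j) r \<le> ennpowr (ennpowr ?S (1 / r)) r"
    using assms by (intro ennpowr_mono) auto
  then show ?thesis using assms by (simp add: ennpowr_ennpowr)
qed

text \<open>The \<open>j\<close>-th dilate \<open>h (\<mu> ^ j * t)\<close> has weighted norm \<open>(\<mu> powr a) ^ - j\<close> times that of \<open>h\<close>.
  The factor \<open>(\<mu> powr a) ^ j\<close> compensates this exactly, and the powers of \<open>\<sigma> < 1\<close> make the bounds of
  the \<open>q\<close>-th powers summable. This replaces Hardy's inequality. The constant must not
  depend on \<open>h\<close>, since it becomes an embedding constant.\<close>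

lemma weighted_norm_SUP_dilates:
  assumes "0 < \<mu>" "0 < \<sigma>" "\<sigma> < 1" "0 < q"
  shows "\<exists>M>0. \<forall>h\<in>borel_measurable borel.
    weighted_norm a q (\<lambda>t. SUP j. ennreal ((\<sigma> * \<mu> powr a) ^ j) * h (\<mu> ^ j * t))
      \<le> ennreal M * weighted_norm a q h"
proof -
  define p where "p = enn2real q"
  define \<rho> where "\<rho> = \<sigma> powr p"
  \<comment> \<open>the \<open>q\<close>-th root of the geometric series of ratio \<open>\<sigma> powr q\<close>\<close>
  define M where "M = (if q = \<infinity> then 1 else (1 / (1 - \<rho>)) powr (1 / p))"
  have p: "0 < p" if "q \<noteq> \<infinity>"
    using that \<open>0 < q\<close> by (simp add: p_def enn2real_positive_iff less_top)
  have \<rho>: "0 < \<rho>" "\<rho> < 1" if "q \<noteq> \<infinity>"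
    using assms p[OF that] powr_less_mono2[of p \<sigma> 1] by (auto simp: \<rho>_def)
  have M: "0 < M" using \<rho> by (auto simp: M_def)
  have "weighted_norm a q (\<lambda>t. SUP j. ennreal ((\<sigma> * \<mu> powr a) ^ j) * h (\<mu> ^ j * t))
      \<le> ennreal M * weighted_norm a q h" if [measurable]: "h \<in> borel_measurable borel" for h
  proof -
    define A where "A = (\<lambda>t. ennreal (t powr a) * h t)"
    have [measurable]: "A \<in> borel_measurable borel" unfolding A_def by measurable
    have shift: "ennreal (t powr a) * (SUP j. ennreal ((\<sigma> * \<mu> powr a) ^ j) * h (\<mu> ^ j * t))
        = (SUP j. ennreal (\<sigma> ^ j) * A (\<mu> ^ j * t))" if "0 < t" for t
    proof -
      have "ennreal (t powr a) * (ennreal ((\<sigma> * \<mu> powr a) ^ j) * h (\<mu> ^ j * t))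
          = ennreal (\<sigma> ^ j) * A (\<mu> ^ j * t)" for j
      proof -
        have "(\<mu> ^ j * t) powr a = (\<mu> powr a) ^ j * t powr a"
          using assms that by (simp add: powr_mult powr_powr powr_realpow[symmetric] mult.commute)
        then show ?thesis
          using assms by (simp add: A_def power_mult_distrib ennreal_mult mult_ac)
      qed
      then show ?thesis by (simp add: SUP_mult_left_ennreal)
    qed
    show ?thesis
    proof (cases "q = \<infinity>")
      case True
      have "(SUP j. ennreal (\<sigma> ^ j) * A (\<mu> ^ j * t)) \<le> (SUP t\<in>{0<..}. A t)" if "0 < t" for t
      proof (rule SUP_least)
        fix j
        have "ennreal (\<sigma> ^ j) * A (\<mu> ^ j * t) \<le> 1 * A (\<mu> ^ j * t)"
          using assms by (intro mult_right_mono) (auto simp: power_le_one)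
        also have "\<dots> \<le> (SUP t\<in>{0<..}. A t)" using assms that by (auto intro: SUP_upper)
        finally show "ennreal (\<sigma> ^ j) * A (\<mu> ^ j * t) \<le> (SUP t\<in>{0<..}. A t)" .
      qed
      then have "(SUP t\<in>{0<..}. ennreal (t powr a) * (SUP j. ennreal ((\<sigma> * \<mu> powr a) ^ j) * h (\<mu> ^ j * t)))
          \<le> (SUP t\<in>{0<..}. A t)"
        by (intro SUP_least) (simp add: shift)
      then show ?thesis
        by (simp add: weighted_norm_def True A_def M_def)
    next
      case False
      note p = p[OF False] and \<rho> = \<rho>[OF False]
      have pw: "ennpowr (ennreal (\<sigma> ^ j) * x) p = ennreal (\<rho> ^ j) * ennpowr x p" for j x
        using p assms
        by (simp add: ennpowr_mult ennpowr_ennreal \<rho>_def powr_powr powr_realpow[symmetric] mult.commute)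
      have "log_integral (\<lambda>t. ennpowr (ennreal (t powr a) *
              (SUP j. ennreal ((\<sigma> * \<mu> powr a) ^ j) * h (\<mu> ^ j * t))) p)
          \<le> log_integral (\<lambda>t. \<Sum>j. ennreal (\<rho> ^ j) * ennpowr (A (\<mu> ^ j * t)) p)"
        by (rule log_integral_mono) (use p in \<open>simp add: shift ennpowr_SUP_le_suminf flip: pw\<close>)
      also have "\<dots> = (\<Sum>j. ennreal (\<rho> ^ j) * log_integral (\<lambda>t. ennpowr (A (\<mu> ^ j * t)) p))"
        by (simp add: log_integral_suminf log_integral_cmult)
      also have "\<dots> = (\<Sum>j. ennreal (\<rho> ^ j) * log_integral (\<lambda>t. ennpowr (A t) p))"
        using assms by (subst log_integral_dilate) auto
      also have "\<dots> = (\<Sum>j. ennreal (\<rho> ^ j)) * log_integral (\<lambda>t. ennpowr (A t) p)"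
        by simp
      also have "(\<Sum>j. ennreal (\<rho> ^ j)) = ennreal (1 / (1 - \<rho>))"
        using \<rho> geometric_sums[of \<rho>] by (intro suminf_ennreal_eq) auto
      finally have "weighted_norm a q (\<lambda>t. SUP j. ennreal ((\<sigma> * \<mu> powr a) ^ j) * h (\<mu> ^ j * t))
          \<le> ennpowr (ennreal (1 / (1 - \<rho>)) * log_integral (\<lambda>t. ennpowr (A t) p)) (1 / p)"
        unfolding weighted_norm_finite_exponent[OF False] p_def[symmetric]
        using p by (intro ennpowr_mono) auto
      also have "\<dots> = ennreal ((1 / (1 - \<rho>)) powr (1 / p)) * weighted_norm a q h"
        unfolding weighted_norm_finite_exponent[OF False] p_def[symmetric] A_def
        using p \<rho> by (subst ennpowr_mult) (auto simp: ennpowr_ennreal)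
      finally show ?thesis using False by (simp add: M_def)
    qed
  qed
  with M show ?thesis by blast
qed

section \<open>The functionals and quasi-norms\<close>

lemma K_functional_mono:
  assumes "quasi_normed F"
  shows "mono (K_functional E F f)"
proof (rule monoI)
  fix s t :: real assume "s \<le> t"
  show "K_functional E F f s \<le> K_functional E F f t"
    unfolding K_functional_def
  proof (rule Inf_mono)
    fix y assume "y \<in> {ennreal (qnorm E f\<^sub>0 + t * qnorm F f\<^sub>1) |f\<^sub>0 f\<^sub>1. f\<^sub>0 \<in> elems E \<and> f\<^sub>1 \<in> elems F \<and> f = f\<^sub>0 + f\<^sub>1}"
    then obtain f0 f1 where y: "y = ennreal (qnorm E f0 + t * qnorm F f1)"
      and f: "f0 \<in> elems E" "f1 \<in> elems F" "f = f0 + f1" by blast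
    have "s * qnorm F f1 \<le> t * qnorm F f1"
      using assms f \<open>s \<le> t\<close> by (intro mult_right_mono) (auto simp: quasi_normed_def)
    then have "ennreal (qnorm E f0 + s * qnorm F f1) \<le> y" unfolding y by (intro ennreal_leI) simp
    then show "\<exists>x\<in>{ennreal (qnorm E f\<^sub>0 + s * qnorm F f\<^sub>1) |f\<^sub>0 f\<^sub>1. f\<^sub>0 \<in> elems E \<and> f\<^sub>1 \<in> elems F \<and> f = f\<^sub>0 + f\<^sub>1}. x \<le> y"
      using f by blast
  qed
qed

lemma approx_error_antimono: "antimono (approx_error E T f)"
  unfolding approx_error_def by (intro antimonoI Inf_superset_mono) force

lemma quasi_triangle:
  assumes "quasi_normed E"
  obtains C where "1 \<le> C"
    "\<And>x y. x \<in> elems E \<Longrightarrow> y \<in> elems E \<Longrightarrow> qnorm E (x + y) \<le> C * (qnorm E x + qnorm E y)"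
    "\<And>x y. x \<in> elems E \<Longrightarrow> y \<in> elems E \<Longrightarrow> qnorm E (x - y) \<le> C * (qnorm E x + qnorm E y)"
proof -
  have "\<exists>C\<ge>1. \<forall>x\<in>elems E. \<forall>y\<in>elems E. qnorm E (x + y) \<le> C * (qnorm E x + qnorm E y)"
    using assms unfolding quasi_normed_def by (elim conjE)
  then obtain C where C: "1 \<le> C"
    "\<And>x y. x \<in> elems E \<Longrightarrow> y \<in> elems E \<Longrightarrow> qnorm E (x + y) \<le> C * (qnorm E x + qnorm E y)"
    by auto
  have "qnorm E (x - y) \<le> C * (qnorm E x + qnorm E y)" if "x \<in> elems E" "y \<in> elems E" for x y
  proof -
    have "- y \<in> elems E" "qnorm E (- y) = qnorm E y"
      using assms that by (auto simp: quasi_normed_def subspace_neg)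
    then show ?thesis using C(2)[of x "- y"] that by simp
  qed
  with C show ?thesis by (intro that[of C]) auto
qed

text \<open>Peeling off one difference at a time costs a factor \<open>C\<close> at each step, so the weights grow
  geometrically. The bound is useful once the differences decay faster than \<open>C ^ - j\<close>.\<close>

lemma quasi_norm_telescope:
  assumes "subspace (elems F)" "0 \<le> C" "\<And>j. g j \<in> elems F"
    and tri: "\<And>x y. x \<in> elems F \<Longrightarrow> y \<in> elems F \<Longrightarrow> qnorm F (x + y) \<le> C * (qnorm F x + qnorm F y)"
  shows "qnorm F (g 0) \<le> (\<Sum>j<m. C ^ Suc j * qnorm F (g j - g (Suc j))) + C ^ m * qnorm F (g m)"
proof (induction m)
  case (Suc m)
  have "C ^ m * qnorm F (g m) \<le> C ^ m * (C * (qnorm F (g m - g (Suc m)) + qnorm F (g (Suc m))))"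
    using tri[of "g m - g (Suc m)" "g (Suc m)"] assms
    by (intro mult_left_mono) (simp_all add: subspace_diff)
  with Suc show ?case by (simp add: algebra_simps)
qed simp

lemma ennreal_Inf_le_mult:
  fixes a :: ennreal
  assumes "0 < c" "\<And>x. x \<in> S \<Longrightarrow> a \<le> ennreal c * x"
  shows "a \<le> ennreal c * Inf S"
proof -
  have "ennreal (1 / c) * a \<le> x" if "x \<in> S" for x
  proof -
    have "ennreal (1 / c) * a \<le> ennreal (1 / c) * (ennreal c * x)"
      using assms(2)[OF that] by (intro mult_left_mono) auto
    also have "\<dots> = x" using \<open>0 < c\<close> by (simp add: mult.assoc[symmetric] flip: ennreal_mult)
    finally show ?thesis .
  qed
  then have "ennreal c * (ennreal (1 / c) * a) \<le> ennreal c * Inf S"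
    by (intro mult_left_mono Inf_greatest) auto
  then show ?thesis using \<open>0 < c\<close> by (simp add: mult.assoc[symmetric] flip: ennreal_mult)
qed

section \<open>Pointwise comparison of the functionals\<close>

text \<open>For a splitting \<open>f = f0 + f1\<close>, an approximant \<open>g\<close> of \<open>f1\<close> is also one of \<open>f\<close>, with error
  \<open>f0 + (f1 - g)\<close>. The Jackson inequality bounds the size of \<open>f1 - g\<close> by
  \<open>t powr - \<beta> * (C * qnorm F f1)\<close> up to an arbitrarily small excess.\<close>

lemma approx_error_le_K_functional:
  assumes E: "quasi_normed E" and F: "quasi_normed F" and FE: "elems F \<subseteq> elems E" and "0 < C"
    and jackson: "\<And>t f. 0 < t \<Longrightarrow> f \<in> elems F \<Longrightarrow>
      ennreal (t powr \<beta>) * approx_error E T f t \<le> ennreal (C * qnorm F f)"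
  shows "\<exists>M>0. \<forall>f t. 0 < t \<longrightarrow> approx_error E T f t \<le> ennreal M * K_functional E F f (t powr - \<beta>)"
proof -
  obtain c where c: "1 \<le> c"
    "\<And>x y. x \<in> elems E \<Longrightarrow> y \<in> elems E \<Longrightarrow> qnorm E (x + y) \<le> c * (qnorm E x + qnorm E y)"
    using quasi_triangle[OF E] by metis
  define M where "M = c * max 1 C"
  have M: "0 < M" "c \<le> M" "c * C \<le> M" using c by (auto simp: M_def mult_le_cancel_left1)
  have bound: "approx_error E T (f0 + f1) t \<le> ennreal (M * (qnorm E f0 + t powr - \<beta> * qnorm F f1))"
    if f: "f0 \<in> elems E" "f1 \<in> elems F" and t: "0 < t" for f0 f1 t
  proof (rule ennreal_le_epsilon)
    fix e :: real assume e: "0 < e"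
    have nn: "0 \<le> qnorm E f0" "0 \<le> qnorm F f1"
      using E F f by (auto simp: quasi_normed_def)
    have "approx_error E T f1 t = ennreal (t powr - \<beta>) * (ennreal (t powr \<beta>) * approx_error E T f1 t)"
      using t by (simp add: mult.assoc[symmetric] powr_add[symmetric] flip: ennreal_mult)
    also have "\<dots> \<le> ennreal (t powr - \<beta>) * ennreal (C * qnorm F f1)"
      by (intro mult_left_mono jackson t f) simp
    also have "\<dots> < ennreal (t powr - \<beta> * (C * qnorm F f1) + e / c)"
      using nn e c \<open>0 < C\<close> by (simp add: ennreal_mult'[symmetric] ennreal_less_iff)
    finally obtain g where g: "g \<in> elems T" "f1 - g \<in> elems E" "qnorm T g \<le> t"
      and "ennreal (qnorm E (f1 - g)) < ennreal (t powr - \<beta> * (C * qnorm F f1) + e / c)"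
      unfolding approx_error_def by (auto simp: Inf_less_iff)
    then have close: "qnorm E (f1 - g) < t powr - \<beta> * (C * qnorm F f1) + e / c"
      using E by (subst (asm) ennreal_less_iff) (auto simp: quasi_normed_def)
    have eq: "f0 + f1 - g = f0 + (f1 - g)" by simp
    have "approx_error E T (f0 + f1) t \<le> ennreal (qnorm E (f0 + f1 - g))"
      unfolding approx_error_def
    proof (rule Inf_lower, intro CollectI exI conjI refl)
      show "f0 + f1 - g \<in> elems E"
        unfolding eq using g f E by (auto simp: quasi_normed_def intro: subspace_add)
    qed (use g in auto)
    also have "qnorm E (f0 + f1 - g) \<le> c * (qnorm E f0 + qnorm E (f1 - g))"
      unfolding eq by (rule c) (use f g in auto)
    also have "\<dots> \<le> c * (qnorm E f0 + (t powr - \<beta> * (C * qnorm F f1) + e / c))"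
      using close c by (intro mult_left_mono) auto
    also have "\<dots> = c * qnorm E f0 + (c * C) * (t powr - \<beta> * qnorm F f1) + e"
      using c by (simp add: field_simps)
    also have "\<dots> \<le> M * qnorm E f0 + M * (t powr - \<beta> * qnorm F f1) + e"
      using M nn by (intro add_mono mult_right_mono) auto
    finally have "approx_error E T (f0 + f1) t
        \<le> ennreal (M * (qnorm E f0 + t powr - \<beta> * qnorm F f1) + e)"
      by (simp add: algebra_simps ennreal_leI)
    then show "approx_error E T (f0 + f1) t
        \<le> ennreal (M * (qnorm E f0 + t powr - \<beta> * qnorm F f1)) + ennreal e"
      using M nn e by (simp add: ennreal_plus)
  qed
  show ?thesis
  proof (rule exI[of _ M], rule conjI[OF M(1)], intro allI impI)
    fix f t assume t: "(0::real) < t"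
    let ?S = "{ennreal (qnorm E f\<^sub>0 + t powr - \<beta> * qnorm F f\<^sub>1) |f\<^sub>0 f\<^sub>1. f\<^sub>0 \<in> elems E \<and> f\<^sub>1 \<in> elems F \<and> f = f\<^sub>0 + f\<^sub>1}"
    show "approx_error E T f t \<le> ennreal M * K_functional E F f (t powr - \<beta>)"
      unfolding K_functional_def
    proof (rule ennreal_Inf_le_mult[OF M(1)])
      fix x assume "x \<in> ?S"
      then obtain f0 f1 where x: "x = ennreal (qnorm E f0 + t powr - \<beta> * qnorm F f1)"
        and f: "f0 \<in> elems E" "f1 \<in> elems F" "f = f0 + f1" by blast
      have "ennreal M * x = ennreal (M * (qnorm E f0 + t powr - \<beta> * qnorm F f1))"
        unfolding x using M(1) by (intro ennreal_mult'[symmetric]) simp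
      then show "approx_error E T f t \<le> ennreal M * x"
        using bound[OF f(1,2) t] f(3) by simp
    qed
  qed
qed

text \<open>Write \<open>\<tau> = \<sigma> * \<mu> powr (\<theta> * \<beta>)\<close> for the damping factor per level, and let \<open>B\<close> exceed the
  supremum on the right. Then there are \<open>g j\<close> in \<open>T\<close> with \<open>qnorm T (g j) \<le> \<mu> ^ j * s\<close> and
  \<open>qnorm E (f - g j) \<le> B / \<tau> ^ j\<close>, and the Bernstein inequality bounds
  \<open>qnorm F (g j - g (j + 1))\<close> by a constant times \<open>s powr \<beta> * B * (\<mu> powr \<beta> / \<tau>) ^ j\<close>.
  Telescoping multiplies this by \<open>cF ^ j\<close>, so \<open>cF * \<mu> powr \<beta> / \<tau> < 1\<close> is required. On the other hand
  \<open>\<sigma> < 1\<close>, that is \<open>\<tau> < \<mu> powr (\<theta> * \<beta>)\<close>, is required for summing the dilates afterwards. Since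
  \<open>\<theta> < 1\<close> there is room between \<open>\<mu> powr \<beta>\<close> and \<open>\<mu> powr (\<theta> * \<beta>)\<close>, and it exceeds any constant when
  \<open>\<mu>\<close> is small.\<close>

lemma K_functional_le_SUP_approx_error:
  assumes E: "quasi_normed E" and F: "quasi_normed F" and T: "quasi_normed T"
    and TF: "elems T \<subseteq> elems F" and FE: "elems F \<subseteq> elems E"
    and "0 < C" "0 < \<beta>" and \<theta>: "0 < \<theta>" "\<theta> < 1"
    and bernstein: "\<And>g. g \<in> elems T \<Longrightarrow> qnorm F g \<le> C * qnorm T g powr \<beta> * qnorm E g"
  shows "\<exists>M>0. \<exists>\<mu> \<sigma>. 0 < \<mu> \<and> 0 < \<sigma> \<and> \<sigma> < 1 \<and> (\<forall>f\<in>elems E. \<forall>s>0.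
    K_functional E F f (s powr - \<beta>) \<le> ennreal M *
      (SUP j. ennreal ((\<sigma> * \<mu> powr (\<theta> * \<beta>)) ^ j) * approx_error E T f (\<mu> ^ j * s)))"
proof -
  obtain cE where cE: "1 \<le> cE"
    "\<And>x y. x \<in> elems E \<Longrightarrow> y \<in> elems E \<Longrightarrow> qnorm E (x - y) \<le> cE * (qnorm E x + qnorm E y)"
    using quasi_triangle[OF E] by metis
  obtain cF where cF: "1 \<le> cF"
    "\<And>x y. x \<in> elems F \<Longrightarrow> y \<in> elems F \<Longrightarrow> qnorm F (x + y) \<le> cF * (qnorm F x + qnorm F y)"
    using quasi_triangle[OF F] by metis
  obtain cT where cT: "1 \<le> cT"
    "\<And>x y. x \<in> elems T \<Longrightarrow> y \<in> elems T \<Longrightarrow> qnorm T (x - y) \<le> cT * (qnorm T x + qnorm T y)"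
    using quasi_triangle[OF T] by metis
  \<comment> \<open>The exponent of \<open>\<tau>\<close>, namely \<open>\<theta> * \<beta> + \<delta> = \<beta> - \<delta>\<close>, is the midpoint between \<open>\<theta> * \<beta>\<close> and \<open>\<beta>\<close>;
    \<open>\<mu>\<close> solves \<open>\<mu> powr \<delta> = 1 / (2 * cF)\<close>, which makes the telescoping series have ratio \<open>1 / 2\<close>.\<close>
  define \<delta> where "\<delta> = \<beta> * (1 - \<theta>) / 2"
  define \<mu> where "\<mu> = (1 / (2 * cF)) powr (1 / \<delta>)"
  define \<sigma> where "\<sigma> = \<mu> powr \<delta>"
  define \<tau> where "\<tau> = \<sigma> * \<mu> powr (\<theta> * \<beta>)"
  have \<delta>: "0 < \<delta>" using assms by (simp add: \<delta>_def)
  have \<sigma>: "\<sigma> = 1 / (2 * cF)" using \<delta> cF by (simp add: \<sigma>_def \<mu>_def powr_powr)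
  have \<sigma>01: "0 < \<sigma>" "\<sigma> < 1" using cF by (auto simp: \<sigma> field_simps)
  have \<mu>01: "0 < \<mu>" "\<mu> < 1"
    using cF \<delta> powr_less_mono2[of "1 / \<delta>" "1 / (2 * cF)" 1] by (auto simp: \<mu>_def field_simps)
  have \<tau>01: "0 < \<tau>" "\<tau> \<le> 1"
    using \<sigma>01 \<mu>01 assms by (auto simp: \<tau>_def intro!: mult_le_one powr_le1)
  have \<mu>\<beta>: "cF * \<mu> powr \<beta> = \<tau> / 2"
  proof -
    have "\<beta> = \<delta> + (\<delta> + \<theta> * \<beta>)" by (simp add: \<delta>_def field_simps)
    then have "\<mu> powr \<beta> = \<sigma> * \<tau>" by (metis powr_add \<sigma>_def \<tau>_def)
    then show ?thesis using cF by (simp add: \<sigma>)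
  qed
  \<comment> \<open>\<open>D\<close> comes from a single difference; \<open>M\<close> collects \<open>f - g 0\<close>, the telescoping series
    and the far end of the chain.\<close>
  define D where "D = C * (2 * cT) powr \<beta> * (2 * cE / \<tau>)"
  define M where "M = 1 + 2 * cF * D + 2 * C * cE"
  have D: "0 < D" using assms cE cT \<tau>01 by (simp add: D_def)
  have M: "0 < M" using D cF cE \<open>0 < C\<close> by (simp add: M_def add_pos_pos)
  have key: "K_functional E F f (s powr - \<beta>) \<le> ennreal (M * B)"
    if f: "f \<in> elems E" and s: "0 < s" and B: "0 < B"
      and lt: "\<And>j. ennreal (\<tau> ^ j) * approx_error E T f (\<mu> ^ j * s) < ennreal B" for f s B
  proof -
    have "\<exists>g. g \<in> elems T \<and> qnorm T g \<le> \<mu> ^ j * s \<and> qnorm E (f - g) \<le> B / \<tau> ^ j" for j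
    proof -
      have "approx_error E T f (\<mu> ^ j * s) = ennreal (1 / \<tau> ^ j) * (ennreal (\<tau> ^ j) * approx_error E T f (\<mu> ^ j * s))"
        using \<tau>01 by (simp add: mult.assoc[symmetric] flip: ennreal_mult)
      also have "\<dots> < ennreal (1 / \<tau> ^ j) * ennreal B"
        using lt[of j] \<tau>01 by (intro ennreal_mult_strict_left_mono) auto
      also have "\<dots> = ennreal (B / \<tau> ^ j)" using \<tau>01 B by (simp flip: ennreal_mult)
      finally obtain g where g: "g \<in> elems T" "f - g \<in> elems E" "qnorm T g \<le> \<mu> ^ j * s"
        and "ennreal (qnorm E (f - g)) < ennreal (B / \<tau> ^ j)"
        unfolding approx_error_def by (auto simp: Inf_less_iff)
      then have "qnorm E (f - g) \<le> B / \<tau> ^ j"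
        using E by (subst (asm) ennreal_less_iff) (auto simp: quasi_normed_def)
      with g show ?thesis by blast
    qed
    then obtain g where gT: "\<And>j. g j \<in> elems T" and gt: "\<And>j. qnorm T (g j) \<le> \<mu> ^ j * s"
      and gE: "\<And>j. qnorm E (f - g j) \<le> B / \<tau> ^ j" by metis
    have gF: "g j \<in> elems F" and gEE: "g j \<in> elems E" for j using gT TF FE by auto
    have sub: "subspace (elems E)" "subspace (elems F)" "subspace (elems T)"
      using E F T by (auto simp: quasi_normed_def)
    have nnE: "0 \<le> qnorm E x" if "x \<in> elems E" for x using E that by (auto simp: quasi_normed_def)
    have nnT: "0 \<le> qnorm T x" if "x \<in> elems T" for x using T that by (auto simp: quasi_normed_def)
    have lev: "(\<mu> ^ j * s) powr \<beta> = s powr \<beta> * (\<mu> powr \<beta>) ^ j" for j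
      using \<mu>01 s by (simp add: powr_mult powr_powr powr_realpow[symmetric] mult.commute)
    have pow: "cF ^ j * (\<mu> powr \<beta>) ^ j = \<tau> ^ j * (1 / 2) ^ j" for j
      by (simp add: power_mult_distrib[symmetric] \<mu>\<beta>)
    have step: "cF ^ Suc j * qnorm F (g j - g (Suc j)) \<le> cF * D * s powr \<beta> * B * (1 / 2) ^ j" for j
    proof -
      let ?x = "g j - g (Suc j)"
      have xT: "?x \<in> elems T" using gT sub by (simp add: subspace_diff)
      have xE: "?x \<in> elems E" using xT TF FE by auto
      have "qnorm T ?x \<le> cT * (qnorm T (g j) + qnorm T (g (Suc j)))" by (intro cT gT)
      also have "\<dots> \<le> cT * (\<mu> ^ j * s + \<mu> ^ j * s)"
      proof -
        have "\<mu> ^ Suc j * s \<le> \<mu> ^ j * s" using \<mu>01 s by simp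
        then show ?thesis using gt[of j] gt[of "Suc j"] cT by (intro mult_left_mono add_mono) auto
      qed
      finally have "qnorm T ?x powr \<beta> \<le> (2 * cT * (\<mu> ^ j * s)) powr \<beta>"
        using nnT[OF xT] \<open>0 < \<beta>\<close> by (intro powr_mono2) (auto simp: mult_ac)
      also have "\<dots> = (2 * cT) powr \<beta> * (s powr \<beta> * (\<mu> powr \<beta>) ^ j)"
        using cT s \<mu>01 by (subst powr_mult) (auto simp: lev)
      finally have 1: "qnorm T ?x powr \<beta> \<le> (2 * cT) powr \<beta> * (s powr \<beta> * (\<mu> powr \<beta>) ^ j)" .
      have "qnorm E ?x = qnorm E ((f - g (Suc j)) - (f - g j))" by simp
      also have "\<dots> \<le> cE * (qnorm E (f - g (Suc j)) + qnorm E (f - g j))"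
        using sub f gEE by (intro cE) (simp_all add: subspace_diff)
      also have "\<dots> \<le> cE * (B / \<tau> ^ Suc j + B / \<tau> ^ Suc j)"
      proof -
        have "B / \<tau> ^ j \<le> B / \<tau> ^ Suc j"
          using B \<tau>01 by (intro divide_left_mono) (auto simp: mult_le_cancel_right1)
        then show ?thesis using gE[of j] gE[of "Suc j"] cE by (intro mult_left_mono add_mono) auto
      qed
      also have "\<dots> = 2 * cE / \<tau> * (B / \<tau> ^ j)" by simp
      finally have 2: "qnorm E ?x \<le> 2 * cE / \<tau> * (B / \<tau> ^ j)" .
      have "qnorm F ?x \<le> C * qnorm T ?x powr \<beta> * qnorm E ?x" by (rule bernstein[OF xT])
      also have "\<dots> \<le> C * ((2 * cT) powr \<beta> * (s powr \<beta> * (\<mu> powr \<beta>) ^ j)) * (2 * cE / \<tau> * (B / \<tau> ^ j))"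
        using 1 2 nnE[OF xE] \<open>0 < C\<close> by (intro mult_mono) auto
      also have "\<dots> = D * s powr \<beta> * B * ((\<mu> powr \<beta>) ^ j / \<tau> ^ j)" by (simp add: D_def)
      finally have "cF ^ Suc j * qnorm F ?x \<le> cF ^ Suc j * (D * s powr \<beta> * B * ((\<mu> powr \<beta>) ^ j / \<tau> ^ j))"
        using cF by (intro mult_left_mono) auto
      also have "\<dots> = cF * D * s powr \<beta> * B * ((cF ^ j * (\<mu> powr \<beta>) ^ j) / \<tau> ^ j)" by simp
      also have "\<dots> = cF * D * s powr \<beta> * B * (1 / 2) ^ j" unfolding pow using \<tau>01 by simp
      finally show ?thesis .
    qed
    \<comment> \<open>The chain is cut at a level where the contribution of \<open>f\<close> itself to \<open>g m\<close> is below \<open>B\<close>.\<close>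
    obtain m where m: "(1 / 2) ^ m * qnorm E f \<le> B"
    proof -
      have "(\<lambda>m. (1 / 2) ^ m * qnorm E f) \<longlonglongrightarrow> 0 * qnorm E f"
        by (intro tendsto_intros LIMSEQ_power_zero) simp
      then have "eventually (\<lambda>m. (1 / 2) ^ m * qnorm E f < B) sequentially"
        using B by (intro order_tendstoD) auto
      then obtain m where "(1 / 2) ^ m * qnorm E f < B" by (auto simp: eventually_sequentially)
      then show ?thesis by (intro that[of m]) simp
    qed
    have tail: "cF ^ m * qnorm F (g m) \<le> 2 * C * cE * s powr \<beta> * B"
    proof -
      have "qnorm T (g m) powr \<beta> \<le> (\<mu> ^ m * s) powr \<beta>"
        using gt[of m] nnT[OF gT] \<open>0 < \<beta>\<close> by (intro powr_mono2) auto
      then have 1: "qnorm T (g m) powr \<beta> \<le> s powr \<beta> * (\<mu> powr \<beta>) ^ m" by (simp add: lev)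
      have "qnorm E (g m) = qnorm E (f - (f - g m))" by simp
      also have "\<dots> \<le> cE * (qnorm E f + qnorm E (f - g m))"
        using sub f gEE by (intro cE) (simp_all add: subspace_diff)
      also have "\<dots> \<le> cE * (qnorm E f + B / \<tau> ^ m)"
        using gE[of m] cE by (intro mult_left_mono add_left_mono) auto
      finally have 2: "qnorm E (g m) \<le> cE * (qnorm E f + B / \<tau> ^ m)" .
      have "qnorm F (g m) \<le> C * qnorm T (g m) powr \<beta> * qnorm E (g m)" by (rule bernstein[OF gT])
      also have "\<dots> \<le> C * (s powr \<beta> * (\<mu> powr \<beta>) ^ m) * (cE * (qnorm E f + B / \<tau> ^ m))"
        using 1 2 nnE[OF gEE] \<open>0 < C\<close> by (intro mult_mono) auto
      finally have "cF ^ m * qnorm F (g m)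
          \<le> cF ^ m * (C * (s powr \<beta> * (\<mu> powr \<beta>) ^ m) * (cE * (qnorm E f + B / \<tau> ^ m)))"
        using cF by (intro mult_left_mono) auto
      also have "\<dots> = C * s powr \<beta> * cE * ((cF ^ m * (\<mu> powr \<beta>) ^ m) * (qnorm E f + B / \<tau> ^ m))"
        by simp
      also have "(cF ^ m * (\<mu> powr \<beta>) ^ m) * (qnorm E f + B / \<tau> ^ m)
          = \<tau> ^ m * ((1 / 2) ^ m * qnorm E f) + (1 / 2) ^ m * B"
        unfolding pow using \<tau>01 by (simp add: algebra_simps)
      also have "C * s powr \<beta> * cE * \<dots> \<le> C * s powr \<beta> * cE * (1 * B + 1 * B)"
        using m \<tau>01 B nnE[OF f] \<open>0 < C\<close> cE
        by (intro mult_left_mono add_mono mult_mono) (auto simp: power_le_one)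
      finally show ?thesis by (simp add: mult_ac)
    qed
    have "qnorm F (g 0) \<le> (\<Sum>j<m. cF ^ Suc j * qnorm F (g j - g (Suc j))) + cF ^ m * qnorm F (g m)"
      by (rule quasi_norm_telescope) (use sub cF gF in auto)
    also have "\<dots> \<le> (\<Sum>j<m. cF * D * s powr \<beta> * B * (1 / 2) ^ j) + 2 * C * cE * s powr \<beta> * B"
      by (intro add_mono sum_mono step tail)
    also have "\<dots> = cF * D * s powr \<beta> * B * (\<Sum>j<m. (1 / 2) ^ j) + 2 * C * cE * s powr \<beta> * B"
      by (simp add: sum_distrib_left)
    also have "\<dots> \<le> cF * D * s powr \<beta> * B * 2 + 2 * C * cE * s powr \<beta> * B"
    proof -
      have "(\<Sum>j<m. (1 / 2 :: real) ^ j) \<le> 2" by (subst geometric_sum) auto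
      then show ?thesis using cF D B by (intro add_right_mono mult_left_mono) auto
    qed
    also have "\<dots> = s powr \<beta> * ((M - 1) * B)" by (simp add: M_def algebra_simps)
    finally have "s powr - \<beta> * qnorm F (g 0) \<le> s powr - \<beta> * (s powr \<beta> * ((M - 1) * B))"
      by (intro mult_left_mono) auto
    also have "\<dots> = (M - 1) * B"
      using s by (simp add: mult.assoc[symmetric] powr_add[symmetric])
    finally have "s powr - \<beta> * qnorm F (g 0) \<le> (M - 1) * B" .
    then have "qnorm E (f - g 0) + s powr - \<beta> * qnorm F (g 0) \<le> M * B"
      using gE[of 0] by (simp add: algebra_simps)
    moreover have "K_functional E F f (s powr - \<beta>) \<le> ennreal (qnorm E (f - g 0) + s powr - \<beta> * qnorm F (g 0))"
      unfolding K_functional_def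
    proof (rule Inf_lower, intro CollectI exI conjI refl)
      show "f - g 0 \<in> elems E" using sub f gEE by (simp add: subspace_diff)
    qed (use gF in auto)
    ultimately show ?thesis by (meson ennreal_leI order_trans)
  qed
  show ?thesis
  proof (rule exI[of _ M], rule conjI[OF M], rule exI[of _ \<mu>], rule exI[of _ \<sigma>],
      intro conjI ballI allI impI \<mu>01(1) \<sigma>01)
    fix f s assume f: "f \<in> elems E" and s: "(0::real) < s"
    define S where "S = (SUP j. ennreal (\<tau> ^ j) * approx_error E T f (\<mu> ^ j * s))"
    have "K_functional E F f (s powr - \<beta>) \<le> ennreal M * S"
    proof (cases "S = top")
      case True
      then show ?thesis using M by (simp add: ennreal_mult_top)
    next
      case False
      \<comment> \<open>\<open>S\<close> may be 0 or not be attained, so the estimate is applied slightly above it.\<close>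
      define B where "B = enn2real S"
      have S: "S = ennreal B" "0 \<le> B" using False by (auto simp: B_def less_top)
      show ?thesis
      proof (rule ennreal_le_epsilon)
        fix e :: real assume e: "0 < e"
        have "ennreal (\<tau> ^ j) * approx_error E T f (\<mu> ^ j * s) < ennreal (B + e / M)" for j
        proof -
          have "ennreal (\<tau> ^ j) * approx_error E T f (\<mu> ^ j * s) \<le> S"
            unfolding S_def by (rule SUP_upper) simp
          also have "\<dots> < ennreal (B + e / M)" using S e M by (simp add: ennreal_less_iff)
          finally show ?thesis .
        qed
        then have "K_functional E F f (s powr - \<beta>) \<le> ennreal (M * (B + e / M))"
          using S e M by (intro key f s) (auto intro: add_nonneg_pos)
        also have "\<dots> = ennreal M * S + ennreal e"
          using S e M by (simp add: distrib_left ennreal_mult)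
        finally show "K_functional E F f (s powr - \<beta>) \<le> ennreal M * S + ennreal e" .
      qed
    qed
    then show "K_functional E F f (s powr - \<beta>) \<le> ennreal M *
      (SUP j. ennreal ((\<sigma> * \<mu> powr (\<theta> * \<beta>)) ^ j) * approx_error E T f (\<mu> ^ j * s))"
      by (simp add: S_def \<tau>_def)
  qed
qed

section \<open>The embeddings\<close>

lemma sum_elems_of_subset:
  assumes "subspace (elems E)" "subspace (elems F)" "elems F \<subseteq> elems E"
  shows "sum_elems E F = elems E"
proof (intro equalityI subsetI)
  fix f assume "f \<in> elems E"
  then have "f = f + 0 \<and> f \<in> elems E \<and> 0 \<in> elems F" using assms(2) by (simp add: subspace_0)
  then show "f \<in> sum_elems E F" unfolding sum_elems_def by blast
qed (use assms in \<open>auto simp: sum_elems_def intro: subspace_add\<close>)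

text \<open>A bound in the extended reals yields both the inclusion, through finiteness, and the estimate
  of the real-valued quasi-norms.\<close>

lemma embedding_weighted_normI:
  assumes "0 < M" "\<And>f. f \<in> A \<Longrightarrow> w f \<le> ennreal M * v f"
  shows "embedding \<lparr>elems = {f \<in> A. v f < \<infinity>}, qnorm = \<lambda>f. enn2real (v f)\<rparr>
                   \<lparr>elems = {f \<in> A. w f < \<infinity>}, qnorm = \<lambda>f. enn2real (w f)\<rparr>"
proof -
  have fin: "w f < \<infinity> \<and> enn2real (w f) \<le> M * enn2real (v f)" if "f \<in> A" "v f < \<infinity>" for f
  proof -
    have lt: "ennreal M * v f < top" using that by (simp add: ennreal_mult_less_top)
    then have "enn2real (w f) \<le> enn2real (ennreal M * v f)" using assms that by (intro enn2real_mono) auto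
    with lt show ?thesis
      using assms(1) assms(2)[OF that(1)] by (auto simp: enn2real_mult intro: le_less_trans)
  qed
  then show ?thesis
    unfolding embedding_def using assms by (auto intro!: exI[of _ M])
qed

lemma jackson_embedding:
  fixes T F E :: "'a::real_vector qspace"
  assumes T: "quasi_normed T" and F: "quasi_normed F" and E: "quasi_normed E"
    and TF: "elems T \<subseteq> elems F" and FE: "elems F \<subseteq> elems E"
    and "0 < C" "0 < \<beta>"
    and jackson: "\<And>t f. 0 < t \<Longrightarrow> f \<in> elems F \<Longrightarrow>
      ennreal (t powr \<beta>) * approx_error E T f t \<le> ennreal (C * qnorm F f)"
    and "0 < q"
  shows "embedding (K_space E F \<theta> q) (approx_space E T (\<theta> * \<beta>) q)"
proof -
  obtain M where M: "0 < M" "\<And>f t. 0 < t \<Longrightarrow>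
      approx_error E T f t \<le> ennreal M * K_functional E F f (t powr - \<beta>)"
    using approx_error_le_K_functional[OF E F FE \<open>0 < C\<close> jackson] by blast
  define c where "c = \<beta> powr (1 / enn2real q)"
  have c: "0 < c" using \<open>0 < \<beta>\<close> by (simp add: c_def)
  have "weighted_norm (\<theta> * \<beta>) q (approx_error E T f)
      \<le> ennreal (M / c) * weighted_norm (- \<theta>) q (K_functional E F f)" for f
  proof -
    have [measurable]: "K_functional E F f \<in> borel_measurable borel"
      using borel_measurable_mono_ennreal K_functional_mono[OF F] by blast
    have "weighted_norm (- \<theta>) q (K_functional E F f)
        = ennreal c * weighted_norm (\<theta> * \<beta>) q (\<lambda>t. K_functional E F f (t powr - \<beta>))"
      using weighted_norm_powr[of "K_functional E F f" "- \<beta>" q "- \<theta>"] \<open>0 < \<beta>\<close> \<open>0 < q\<close>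
      by (simp add: c_def)
    then have eq: "ennreal (M / c) * weighted_norm (- \<theta>) q (K_functional E F f)
        = ennreal M * weighted_norm (\<theta> * \<beta>) q (\<lambda>t. K_functional E F f (t powr - \<beta>))"
      using c M by (simp add: mult.assoc[symmetric] flip: ennreal_mult)
    have "weighted_norm (\<theta> * \<beta>) q (approx_error E T f)
        \<le> weighted_norm (\<theta> * \<beta>) q (\<lambda>t. ennreal M * K_functional E F f (t powr - \<beta>))"
      by (intro weighted_norm_mono M \<open>0 < q\<close>)
    also have "\<dots> = ennreal M * weighted_norm (\<theta> * \<beta>) q (\<lambda>t. K_functional E F f (t powr - \<beta>))"
      by (rule weighted_norm_cmult) (use M \<open>0 < q\<close> in auto)
    finally show ?thesis unfolding eq .
  qed
  moreover have "sum_elems E F = elems E" "sum_elems E T = elems E"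
    using E F T TF FE by (auto simp: quasi_normed_def sum_elems_of_subset)
  ultimately show ?thesis
    unfolding K_space_def approx_space_def using M c
    by (simp only:) (rule embedding_weighted_normI[of "M / c"], auto)
qed

lemma bernstein_embedding:
  fixes T F E :: "'a::real_vector qspace"
  assumes T: "quasi_normed T" and F: "quasi_normed F" and E: "quasi_normed E"
    and TF: "elems T \<subseteq> elems F" and FE: "elems F \<subseteq> elems E"
    and "0 < C" "0 < \<beta>"
    and bernstein: "\<And>g. g \<in> elems T \<Longrightarrow> qnorm F g \<le> C * qnorm T g powr \<beta> * qnorm E g"
    and "0 < \<theta>" "\<theta> < 1" "0 < q"
  shows "embedding (approx_space E T (\<theta> * \<beta>) q) (K_space E F \<theta> q)"
proof -
  obtain M \<mu> \<sigma> where M: "0 < M" and \<mu>\<sigma>: "0 < \<mu>" "0 < \<sigma>" "\<sigma> < 1"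
    and K: "\<forall>f\<in>elems E. \<forall>s>0. K_functional E F f (s powr - \<beta>) \<le> ennreal M *
      (SUP j. ennreal ((\<sigma> * \<mu> powr (\<theta> * \<beta>)) ^ j) * approx_error E T f (\<mu> ^ j * s))"
    using K_functional_le_SUP_approx_error[OF E F T TF FE \<open>0 < C\<close> \<open>0 < \<beta>\<close> \<open>0 < \<theta>\<close> \<open>\<theta> < 1\<close> bernstein]
    by blast
  have mE: "approx_error E T f \<in> borel_measurable borel" for f
    using borel_measurable_mono_ennreal approx_error_antimono by blast
  obtain N where N: "0 < N" "\<forall>h\<in>borel_measurable borel. weighted_norm (\<theta> * \<beta>) q
      (\<lambda>s. SUP j. ennreal ((\<sigma> * \<mu> powr (\<theta> * \<beta>)) ^ j) * h (\<mu> ^ j * s))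
    \<le> ennreal N * weighted_norm (\<theta> * \<beta>) q h"
    using weighted_norm_SUP_dilates[OF \<mu>\<sigma> \<open>0 < q\<close>, of "\<theta> * \<beta>"] by blast
  define c where "c = \<beta> powr (1 / enn2real q)"
  have c: "0 < c" using \<open>0 < \<beta>\<close> by (simp add: c_def)
  have "weighted_norm (- \<theta>) q (K_functional E F f)
      \<le> ennreal (c * M * N) * weighted_norm (\<theta> * \<beta>) q (approx_error E T f)" if "f \<in> elems E" for f
  proof -
    note mE[of f, measurable]
    have [measurable]: "K_functional E F f \<in> borel_measurable borel"
      using borel_measurable_mono_ennreal K_functional_mono[OF F] by blast
    have "weighted_norm (- \<theta>) q (K_functional E F f)
        = ennreal c * weighted_norm (\<theta> * \<beta>) q (\<lambda>t. K_functional E F f (t powr - \<beta>))"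
      using weighted_norm_powr[of "K_functional E F f" "- \<beta>" q "- \<theta>"] \<open>0 < \<beta>\<close> \<open>0 < q\<close>
      by (simp add: c_def)
    also have "\<dots> \<le> ennreal c * weighted_norm (\<theta> * \<beta>) q (\<lambda>s. ennreal M *
        (SUP j. ennreal ((\<sigma> * \<mu> powr (\<theta> * \<beta>)) ^ j) * approx_error E T f (\<mu> ^ j * s)))"
      by (intro mult_left_mono weighted_norm_mono K[rule_format] \<open>0 < q\<close> that) auto
    also have "\<dots> = ennreal c * (ennreal M * weighted_norm (\<theta> * \<beta>) q (\<lambda>s.
        SUP j. ennreal ((\<sigma> * \<mu> powr (\<theta> * \<beta>)) ^ j) * approx_error E T f (\<mu> ^ j * s)))"
      using M \<open>0 < q\<close> by (subst weighted_norm_cmult) auto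
    also have "\<dots> \<le> ennreal c * (ennreal M * (ennreal N * weighted_norm (\<theta> * \<beta>) q (approx_error E T f)))"
      by (intro mult_left_mono N(2)[rule_format]) auto
    also have "\<dots> = ennreal (c * M * N) * weighted_norm (\<theta> * \<beta>) q (approx_error E T f)"
      using c M N by (simp add: ennreal_mult mult.assoc)
    finally show ?thesis .
  qed
  moreover have "sum_elems E F = elems E" "sum_elems E T = elems E"
    using E F T TF FE by (auto simp: quasi_normed_def sum_elems_of_subset)
  ultimately show ?thesis
    unfolding K_space_def approx_space_def using M c N
    by (simp only:) (rule embedding_weighted_normI[of "c * M * N"], auto)
qed

theorem theorem3p14:
  fixes T F E :: "'a::real_vector qspace"
  assumes "quasi_normed T" and "quasi_normed F" and "quasi_normed E"
    and "elems T \<subseteq> elems F" and "elems F \<subseteq> elems E"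
    and "qspace_pair E F" and "qspace_pair E T"
    and "complete_qspace E" and "complete_qspace F"
  shows "(\<forall>C \<beta> :: real. C > 0 \<and> \<beta> > 0 \<and>
            (\<forall>t>0. \<forall>f\<in>elems F.
               ennreal (t powr \<beta>) * approx_error E T f t \<le> ennreal (C * qnorm F f))
          \<longrightarrow> (\<forall>(\<theta>::real) (q::ennreal). 0 < \<theta> \<and> \<theta> < 1 \<and> 0 < q \<longrightarrow>
                 embedding (K_space E F \<theta> q) (approx_space E T (\<theta> * \<beta>) q)))
       \<and> (\<forall>C \<beta> :: real. C > 0 \<and> \<beta> > 0 \<and>
            (\<forall>f\<in>elems T. qnorm F f \<le> C * qnorm T f powr \<beta> * qnorm E f)
          \<longrightarrow> (\<forall>(\<theta>::real) (q::ennreal). 0 < \<theta> \<and> \<theta> < 1 \<and> 0 < q \<longrightarrow>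
                 embedding (approx_space E T (\<theta> * \<beta>) q) (K_space E F \<theta> q)))"
proof (intro conjI allI impI)
  fix C \<beta> \<theta> :: real and q :: ennreal
  assume "C > 0 \<and> \<beta> > 0 \<and> (\<forall>t>0. \<forall>f\<in>elems F.
      ennreal (t powr \<beta>) * approx_error E T f t \<le> ennreal (C * qnorm F f))"
    and "0 < \<theta> \<and> \<theta> < 1 \<and> 0 < q"
  then show "embedding (K_space E F \<theta> q) (approx_space E T (\<theta> * \<beta>) q)"
    using assms by (intro jackson_embedding[of T F E C]) auto
next
  fix C \<beta> \<theta> :: real and q :: ennreal
  assume "C > 0 \<and> \<beta> > 0 \<and> (\<forall>f\<in>elems T. qnorm F f \<le> C * qnorm T f powr \<beta> * qnorm E f)"
    and "0 < \<theta> \<and> \<theta> < 1 \<and> 0 < q"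
  then show "embedding (approx_space E T (\<theta> * \<beta>) q) (K_space E F \<theta> q)"
    using assms by (intro bernstein_embedding[of T F E C]) auto
qed

end
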